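(* Let $\Omega$ and $X$ be non-empty sets. Let $j_X: X\to \mathcal{L}(X,\Omega)\subseteq \mathcal{P}(X,\Omega)$ be the map sending $x\in X$ to the path $\ell_x$ consisting of a single level step decorated by $x$. (a) The quadruple $\big(\mathcal{P}(X,\Omega),\circ,\{/_\omega\ \backslash_\omega \mid \omega\in\Omega\}, j_X\big)$ is the free $\Omega$-operated monoid on $X$. More precisely, for any $\Omega$-operated monoid $(H,\{\alpha_\omega\mid \omega\in\Omega\})$, consisting of a monoid $H$ and maps $\alpha_\omega:H\to H$ for $\omega\in\Omega$, and any map $f:X\to H$, there is a unique morphism $\bar f: (\mathcal{P}(X,\Omega),\{/_\omega\ \backslash_\omega\mid\omega\in\Omega\})\to (H,\{\alpha_\omega\mid\omega\in\Omega\})$ of $\Omega$-operated monoids such that $f=\bar f\circ j_X$. (b) The quadruple $\big(\mathcal{L}(X,\Omega),\circ,\{/_\omega\ \backslash_\omega\mid\omega\in\Omega\}, j_X\big)$ is the free $\Omega$-operated semigroup on $X$. (c) The triple $\big(\mathcal{D}(\Omega),\circ,\{/_\omega\ \backslash_\omega\mid\omega\in\Omega\}\big)$ is the free $\Omega$-operated monoid on the empty set.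
   Context: **Operated semigroups and monoids.** An $\Omega$-operated semigroup (resp. monoid) is a semigroup (resp. monoid) $U$ together with a family of maps of sets $\alpha_\omega:U\to U$, $\omega\in\Omega$ (no compatibility with the product is required). A morphism $(U,\{\alpha_\omega\})\to(V,\{\beta_\omega\})$ is a semigroup (resp. monoid) homomorphism $f:U\to V$ with $f\circ\alpha_\omega=\beta_\omega\circ f$ for all $\omega\in\Omega$. The free $\Omega$-operated semigroup (resp. monoid) on a set $Y$ is an $\Omega$-operated semigroup (resp. monoid) $U_Y$ with a map $j_Y:Y\to U_Y$ such that for every $\Omega$-operated semigroup (resp. monoid) $V$ and every map $f:Y\to V$ there is a unique morphism $\bar f:U_Y\to V$ with $f=\bar f\circ j_Y$; when $Y=\emptyset$ the map $j_Y$ is dropped from the notation. **Motzkin paths.** A Motzkin path is a lattice path in $\mathbb{N}^2$ (with $\mathbb{N}$ the non-negative integers) from $(0,0)$ to some $(n,0)$, $n\ge 0$, with steps $(1,1)$ (up), $(1,-1)$ (down) and $(1,0)$ (level). The trivial path (a single point) is denoted $\bullet$. A matching pair of steps consists of an up step and a down step to its right such that the path strictly between them is a Motzkin path. An $(X,\Omega)$-decorated Motzkin path is a Motzkin path in which each matching pair of steps is decorated by an element of $\Omega$ (the same element on both steps of the pair) and each level step is decorated by an element of $X$. $\mathcal{P}(X,\Omega)$ is the set of these. The link product $\mathfrak{m}\circ\mathfrak{m}'$ joins the last vertex of $\mathfrak{m}$ with the first vertex of $\mathfrak{m}'$. For $\omega\in\Omega$, the raising operator sends $\mathfrak{m}$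 to $/_\omega\,\mathfrak{m}\,\backslash_\omega$, the path obtained by adding an up step at the left end and a down step at the right end, both decorated by $\omega$. A path is peak-free if it is not $\bullet$ and has no up step immediately followed by a down step; $\mathcal{L}(X,\Omega)\subseteq\mathcal{P}(X,\Omega)$ is the set of peak-free $(X,\Omega)$-decorated Motzkin paths. A Dyck path is a Motzkin path with no level steps (including $\bullet$); $\mathcal{D}(\Omega)\subseteq \mathcal{P}(X,\Omega)$ is the set of $\Omega$-decorated Dyck paths. $\mathcal{L}(X,\Omega)$ and $\mathcal{D}(\Omega)$ carry the restricted product and raising operators. *)

theory Defs
  imports "HOL-Algebra.Group" "HOL-Library.Product_Plus"
begin

section \<open>Operated semigroups and monoids\<close>

text \<open>
  HOL-Algebra has no locale for semigroups. Here a semigroup is a record of type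
  \<^typ>\<open>'a monoid\<close> whose \<open>one\<close> field is ignored (it need not even lie in the carrier),
  so that \<^const>\<open>hom\<close>, which only mentions multiplication, is the set of semigroup
  homomorphisms.
\<close>

definition operated_semigroup ::
    "'w set \<Rightarrow> 'a monoid \<Rightarrow> ('w \<Rightarrow> 'a \<Rightarrow> 'a) \<Rightarrow> bool" where
  "operated_semigroup \<Omega> U \<alpha> \<longleftrightarrow>
     (\<forall>a\<in>carrier U. \<forall>b\<in>carrier U. a \<otimes>\<^bsub>U\<^esub> b \<in> carrier U) \<and>
     (\<forall>a\<in>carrier U. \<forall>b\<in>carrier U. \<forall>c\<in>carrier U.
        (a \<otimes>\<^bsub>U\<^esub> b) \<otimes>\<^bsub>U\<^esub> c = a \<otimes>\<^bsub>U\<^esub> (b \<otimes>\<^bsub>U\<^esub> c)) \<and>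
     (\<forall>\<omega>\<in>\<Omega>. \<alpha> \<omega> \<in> carrier U \<rightarrow> carrier U)"

definition operated_monoid ::
    "'w set \<Rightarrow> 'a monoid \<Rightarrow> ('w \<Rightarrow> 'a \<Rightarrow> 'a) \<Rightarrow> bool" where
  "operated_monoid \<Omega> U \<alpha> \<longleftrightarrow> monoid U \<and> (\<forall>\<omega>\<in>\<Omega>. \<alpha> \<omega> \<in> carrier U \<rightarrow> carrier U)"

definition operated_semigroup_hom ::
    "'w set \<Rightarrow> 'a monoid \<Rightarrow> ('w \<Rightarrow> 'a \<Rightarrow> 'a) \<Rightarrow> 'h monoid \<Rightarrow> ('w \<Rightarrow> 'h \<Rightarrow> 'h) \<Rightarrow> ('a \<Rightarrow> 'h) set" where
  "operated_semigroup_hom \<Omega> U \<alpha> V \<beta> =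
     {g \<in> hom U V. \<forall>\<omega>\<in>\<Omega>. \<forall>u\<in>carrier U. g (\<alpha> \<omega> u) = \<beta> \<omega> (g u)}"

definition operated_monoid_hom ::
    "'w set \<Rightarrow> 'a monoid \<Rightarrow> ('w \<Rightarrow> 'a \<Rightarrow> 'a) \<Rightarrow> 'h monoid \<Rightarrow> ('w \<Rightarrow> 'h \<Rightarrow> 'h) \<Rightarrow> ('a \<Rightarrow> 'h) set" where
  "operated_monoid_hom \<Omega> U \<alpha> V \<beta> =
     {g \<in> operated_semigroup_hom \<Omega> U \<alpha> V \<beta>. g \<one>\<^bsub>U\<^esub> = \<one>\<^bsub>V\<^esub>}"

text \<open>
  The universal property quantifies over all targets \<open>V\<close> on the type \<open>'h\<close>, which is passed as
  an argument; a theorem with \<open>'h\<close> a type variable covers targets on every type.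
  A map out of \<open>U\<close> is represented by its unique extensional representative on
  \<open>carrier U\<close>, so \<open>\<exists>!\<close> expresses uniqueness on the carrier.
\<close>

definition free_operated_monoid ::
    "'h itself \<Rightarrow> 'w set \<Rightarrow> 'y set \<Rightarrow> 'a monoid \<Rightarrow> ('w \<Rightarrow> 'a \<Rightarrow> 'a) \<Rightarrow> ('y \<Rightarrow> 'a) \<Rightarrow> bool" where
  "free_operated_monoid (_ :: 'h itself) \<Omega> Y U \<alpha> j \<longleftrightarrow>
     operated_monoid \<Omega> U \<alpha> \<and> j \<in> Y \<rightarrow> carrier U \<and>
     (\<forall>(V :: 'h monoid) \<beta> f. operated_monoid \<Omega> V \<beta> \<longrightarrow> f \<in> Y \<rightarrow> carrier V \<longrightarrow>
        (\<exists>!g. g \<in> extensional (carrier U) \<and> g \<in> operated_monoid_hom \<Omega> U \<alpha> V \<beta> \<and>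
              (\<forall>y\<in>Y. f y = g (j y))))"

definition free_operated_semigroup ::
    "'h itself \<Rightarrow> 'w set \<Rightarrow> 'y set \<Rightarrow> 'a monoid \<Rightarrow> ('w \<Rightarrow> 'a \<Rightarrow> 'a) \<Rightarrow> ('y \<Rightarrow> 'a) \<Rightarrow> bool" where
  "free_operated_semigroup (_ :: 'h itself) \<Omega> Y U \<alpha> j \<longleftrightarrow>
     operated_semigroup \<Omega> U \<alpha> \<and> j \<in> Y \<rightarrow> carrier U \<and>
     (\<forall>(V :: 'h monoid) \<beta> f. operated_semigroup \<Omega> V \<beta> \<longrightarrow> f \<in> Y \<rightarrow> carrier V \<longrightarrow>
        (\<exists>!g. g \<in> extensional (carrier U) \<and> g \<in> operated_semigroup_hom \<Omega> U \<alpha> V \<beta> \<and>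
              (\<forall>y\<in>Y. f y = g (j y))))"


section \<open>Decorated Motzkin paths\<close>

text \<open>
  A lattice path starting at the origin is given by its list of steps, the trivial path being
  the empty list. Every step carries its decoration; for the path shape the decorations are
  irrelevant.
\<close>

datatype ('x, 'w) step = Up 'w | Down 'w | Level 'x

primrec displacement :: "('x, 'w) step \<Rightarrow> int \<times> int" where
  "displacement (Up w) = (1, 1)"
| "displacement (Down w) = (1, -1)"
| "displacement (Level x) = (1, 0)"

definition vertex :: "('x, 'w) step list \<Rightarrow> nat \<Rightarrow> int \<times> int" where
  "vertex p k = (\<Sum>i<k. displacement (p ! i))"

definition motzkin_path :: "('x, 'w) step list \<Rightarrow> bool" where
  "motzkin_path p \<longleftrightarrow>
     (\<forall>k\<le>length p. fst (vertex p k) \<ge> 0 \<and> snd (vertex p k) \<ge> 0) \<and>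
     (\<exists>n::nat. vertex p (length p) = (int n, 0))"

text \<open>
  In \<open>u @ [Up a] @ q @ [Down b] @ v\<close> with \<open>q\<close> a Motzkin path (up to translation), the two
  displayed steps form a matching pair, and all matching pairs arise in this way.
\<close>

definition matching_decorations_agree :: "('x, 'w) step list \<Rightarrow> bool" where
  "matching_decorations_agree p \<longleftrightarrow>
     (\<forall>u a q b v. p = u @ [Up a] @ q @ [Down b] @ v \<longrightarrow> motzkin_path q \<longrightarrow> a = b)"

primrec decorated_in :: "'x set \<Rightarrow> 'w set \<Rightarrow> ('x, 'w) step \<Rightarrow> bool" where
  "decorated_in X \<Omega> (Up w) \<longleftrightarrow> w \<in> \<Omega>"
| "decorated_in X \<Omega> (Down w) \<longleftrightarrow> w \<in> \<Omega>"
| "decorated_in X \<Omega> (Level x) \<longleftrightarrow> x \<in> X"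

definition motzkin_paths :: "'x set \<Rightarrow> 'w set \<Rightarrow> ('x, 'w) step list set" where
  "motzkin_paths X \<Omega> =
     {p. motzkin_path p \<and> matching_decorations_agree p \<and> (\<forall>s\<in>set p. decorated_in X \<Omega> s)}"

definition peak_free :: "('x, 'w) step list \<Rightarrow> bool" where
  "peak_free p \<longleftrightarrow> p \<noteq> [] \<and> \<not> (\<exists>u a b v. p = u @ [Up a, Down b] @ v)"

definition peak_free_paths :: "'x set \<Rightarrow> 'w set \<Rightarrow> ('x, 'w) step list set" where
  "peak_free_paths X \<Omega> = {p \<in> motzkin_paths X \<Omega>. peak_free p}"

definition no_level_steps :: "('x, 'w) step list \<Rightarrow> bool" where
  "no_level_steps p \<longleftrightarrow> (\<forall>x. Level x \<notin> set p)"

definition dyck_paths :: "'w set \<Rightarrow> ('x, 'w) step list set" where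
  "dyck_paths \<Omega> = {p \<in> motzkin_paths UNIV \<Omega>. no_level_steps p}"

text \<open>The set of level decorations is immaterial for Dyck paths:\<close>

lemma dyck_paths_eq: "dyck_paths \<Omega> = {p \<in> motzkin_paths X \<Omega>. no_level_steps p}"
proof -
  have "decorated_in UNIV \<Omega> s \<longleftrightarrow> decorated_in X \<Omega> s"
    if "no_level_steps p" "s \<in> set p" for p and s :: "('a, 'b) step"
    using that by (cases s) (auto simp: no_level_steps_def)
  then show ?thesis
    by (auto simp: dyck_paths_def motzkin_paths_def)
qed

definition link :: "('x, 'w) step list \<Rightarrow> ('x, 'w) step list \<Rightarrow> ('x, 'w) step list" where
  "link p q = p @ q"

definition raising :: "'w \<Rightarrow> ('x, 'w) step list \<Rightarrow> ('x, 'w) step list" where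
  "raising \<omega> p = [Up \<omega>] @ p @ [Down \<omega>]"

definition level_path :: "'x \<Rightarrow> ('x, 'w) step list" where
  "level_path x = [Level x]"

definition motzkin_monoid :: "'x set \<Rightarrow> 'w set \<Rightarrow> ('x, 'w) step list monoid" where
  "motzkin_monoid X \<Omega> = \<lparr>carrier = motzkin_paths X \<Omega>, mult = link, one = []\<rparr>"

text \<open>The \<open>one\<close> field of the following semigroup is a dummy.\<close>

definition peak_free_semigroup :: "'x set \<Rightarrow> 'w set \<Rightarrow> ('x, 'w) step list monoid" where
  "peak_free_semigroup X \<Omega> = \<lparr>carrier = peak_free_paths X \<Omega>, mult = link, one = []\<rparr>"

definition dyck_monoid :: "'w set \<Rightarrow> ('x, 'w) step list monoid" where
  "dyck_monoid \<Omega> = \<lparr>carrier = dyck_paths \<Omega>, mult = link, one = []\<rparr>"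

end

theory Submission
  imports Defs
begin

text \<open>
  Freeness amounts to unique readability of paths: cutting a path at its first return to the axis
  shows that the decorated paths are exactly what the trivial path and the single level steps
  generate under raising and linking (\<open>motzkin_paths_induct\<close>), and a path can be parsed
  deterministically from left to right.

  Generation gives uniqueness of a morphism with prescribed values on level steps.
  Existence comes from running the parser as a stack machine in the target \<open>V\<close>
  (\<open>stack_eval\<close>): an up step suspends the product computed so far and starts a new one, and a
  down step with decoration \<open>\<omega>\<close> multiplies \<open>\<beta> \<omega>\<close> of the current product onto the suspended one.
  Reading a complete path multiplies the current product by a value depending only on that path
  (\<open>stack_eval_append\<close>), and from this the morphism laws follow.

  The other two claims reduce to the first. Dyck paths are the Motzkin paths with an empty set
  of level decorations. For the peak-free paths, a unit is adjoined to the target semigroup; the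
  operators send this unit to itself, so the morphism from all Motzkin paths exists, and
  on a peak-free path it never takes the adjoined unit as value because the peak-free paths are
  generated by level steps without the trivial path (\<open>peak_free_paths_induct\<close>).
\<close>

section \<open>Heights and first returns\<close>

definition height :: "('x, 'w) step list \<Rightarrow> int" where
  "height p = sum_list (map (\<lambda>s. snd (displacement s)) p)"

lemma height_simps [simp]:
  "height [] = 0"
  "height (s # p) = snd (displacement s) + height p"
  "height (p @ q) = height p + height q"
  by (simp_all add: height_def)

lemma fst_vertex:
  fixes p :: "('x, 'w) step list"
  shows "fst (vertex p k) = int k"
proof -
  have "fst (displacement s) = 1" for s :: "('x, 'w) step"
    by (cases s) auto
  then show ?thesis
    by (simp add: vertex_def fst_sum)
qed

lemma snd_vertex: "k \<le> length p \<Longrightarrow> snd (vertex p k) = height (take k p)"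
  by (simp add: vertex_def snd_sum height_def sum_list_sum_nth atLeast0LessThan min_def)

text \<open>
  The coordinates of vertices carry no information beyond the heights of prefixes, and prefixes
  written as summands of an append fit the case analyses below better than indices.
\<close>

lemma motzkin_path_iff:
  "motzkin_path p \<longleftrightarrow> (\<forall>u v. p = u @ v \<longrightarrow> 0 \<le> height u) \<and> height p = 0"
proof -
  have "(\<forall>k\<le>length p. 0 \<le> height (take k p)) \<longleftrightarrow> (\<forall>u v. p = u @ v \<longrightarrow> 0 \<le> height u)"
    by (metis append_eq_conv_conj append_take_drop_id length_append le_add1)
  then show ?thesis
    by (auto simp: motzkin_path_def fst_vertex snd_vertex prod_eq_iff)
qed

lemma motzkin_path_prefix: "motzkin_path (u @ v) \<Longrightarrow> 0 \<le> height u"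
  by (simp add: motzkin_path_iff)

lemma motzkin_path_suffix:
  assumes "motzkin_path (u @ v)"
  shows "height v \<le> 0"
proof -
  have "0 \<le> height u" "height (u @ v) = 0"
    using assms by (auto simp only: motzkin_path_iff)
  then show ?thesis
    by simp
qed

lemma motzkin_path_height: "motzkin_path p \<Longrightarrow> height p = 0"
  by (simp add: motzkin_path_iff)

lemma motzkin_path_Nil: "motzkin_path []"
  by (simp add: motzkin_path_iff)

lemma motzkin_path_append:
  assumes "motzkin_path p" "motzkin_path q"
  shows "motzkin_path (p @ q)"
  using assms unfolding motzkin_path_iff by (fastforce simp: append_eq_append_conv2)

lemma motzkin_path_append_right:
  assumes "motzkin_path (p @ q)" "height p = 0"
  shows "motzkin_path q"
  unfolding motzkin_path_iff
proof (intro conjI allI impI)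
  fix u v
  assume "q = u @ v"
  then have "0 \<le> height (p @ u)"
    using assms(1) motzkin_path_prefix[of "p @ u" v] by simp
  then show "0 \<le> height u"
    using assms(2) by simp
next
  show "height q = 0"
    using motzkin_path_height[OF assms(1)] assms(2) by simp
qed

lemma motzkin_path_raising:
  assumes "motzkin_path p"
  shows "motzkin_path (raising w p)"
  unfolding motzkin_path_iff
proof (intro conjI allI impI)
  fix u v
  assume "raising w p = u @ v"
  then consider "u = []" | u' where "u = Up w # u'" "p @ [Down w] = u' @ v"
    by (auto simp: raising_def Cons_eq_append_conv)
  then show "0 \<le> height u"
  proof cases
    case 2
    show ?thesis
    proof (cases v rule: rev_cases)
      case Nil
      have "height u' = -1"
        using 2 Nil motzkin_path_height[OF assms] by (metis append_Nil2 height_simps add_0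
            add.right_neutral displacement.simps(2) snd_conv)
      then show ?thesis
        using 2 by simp
    next
      case (snoc v' s)
      have "p = u' @ v'"
        using 2 snoc by simp
      then show ?thesis
        using 2 motzkin_path_prefix assms by fastforce
    qed
  qed simp
qed (use motzkin_path_height[OF assms] in \<open>simp add: raising_def\<close>)

text \<open>
  The step at which a walk first goes below its starting height is a down step, and the walk
  before that step is a Motzkin path. Applied to the part of a Motzkin path after an initial up
  step, this finds the partner of that up step.
\<close>

lemma first_descent:
  assumes "height p < 0"
  obtains q w r where "p = q @ Down w # r" "motzkin_path q"
  using assms
proof (induction p arbitrary: thesis rule: length_induct)
  case (1 p)
  show ?case
  proof (cases "\<exists>u v. p = u @ v \<and> v \<noteq> [] \<and> height u < 0")
    case True
    then obtain u v where uv: "p = u @ v" "v \<noteq> []" "height u < 0"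
      by blast
    then have "length u < length p"
      by simp
    then obtain q w r where "u = q @ Down w # r" "motzkin_path q"
      using "1.IH" uv(3) by blast
    then show ?thesis
      using "1.prems"(1)[of q w "r @ v"] uv(1) by simp
  next
    case False
    have "p \<noteq> []"
      using "1.prems"(2) by auto
    then obtain q s where p: "p = q @ [s]"
      by (cases p rule: rev_cases) auto
    have nonneg: "0 \<le> height u" if "q = u @ v" for u v
      using False p that by (metis append.assoc append_is_Nil_conv not_Cons_self2 not_less)
    then have "0 \<le> height q"
      by (metis append_Nil2)
    then obtain w where "s = Down w" "height q = 0"
      using "1.prems"(2) p by (cases s) auto
    then show ?thesis
      using "1.prems"(1)[of q w "[]"] p nonneg by (auto simp: motzkin_path_iff)
  qed
qed

section \<open>Closure of the decorated paths under linking and raising\<close>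

lemma append_eq_append_ConsE:
  assumes "p @ q = u @ s # v"
  obtains (left) t where "p = u @ s # t" "t @ q = v" | (right) t where "q = t @ s # v" "u = p @ t"
  using assms by (auto simp: append_eq_append_conv2 append_eq_Cons_conv)

lemma matching_decorations_agreeD:
  assumes "matching_decorations_agree p" "p = u @ Up a # q @ Down b # v" "motzkin_path q"
  shows "a = b"
  using assms unfolding matching_decorations_agree_def
  by (metis append_Cons append_Nil)

lemma matching_decorations_agreeI:
  assumes "\<And>u a q b v. p = u @ Up a # q @ Down b # v \<Longrightarrow> motzkin_path q \<Longrightarrow> a = b"
  shows "matching_decorations_agree p"
  using assms unfolding matching_decorations_agree_def by auto

lemma matching_decorations_agree_factor:
  assumes "matching_decorations_agree (l @ p @ r)"
  shows "matching_decorations_agree p"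
proof (rule matching_decorations_agreeI)
  fix u a q b v
  assume "p = u @ Up a # q @ Down b # v" "motzkin_path q"
  then show "a = b"
    using matching_decorations_agreeD[OF assms, of "l @ u" a q b "v @ r"] by simp
qed

text \<open>
  A matching pair cannot straddle the joint of two linked paths: from its up step to the end of
  the first path, the height would have to increase by at least one.
\<close>

lemma matching_decorations_agree_append:
  assumes "motzkin_path p" "matching_decorations_agree p" "matching_decorations_agree q"
  shows "matching_decorations_agree (p @ q)"
proof (rule matching_decorations_agreeI)
  fix u a m b v
  assume eq: "p @ q = u @ Up a # m @ Down b # v" and m: "motzkin_path m"
  from eq show "a = b"
  proof (cases rule: append_eq_append_ConsE)
    case right
    show ?thesis
      by (rule matching_decorations_agreeD[OF assms(3) right(1) m])
  next
    case (left t)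
    from left(2) show ?thesis
    proof (cases rule: append_eq_append_ConsE)
      case left': (left t')
      have "p = u @ Up a # m @ Down b # t'"
        using left(1) left'(1) by simp
      then show ?thesis
        by (rule matching_decorations_agreeD[OF assms(2) _ m])
    next
      case right
      have "0 \<le> height t"
        using m motzkin_path_prefix[of t] right(2) by simp
      moreover have "height (Up a # t) \<le> 0"
        using motzkin_path_suffix[of u "Up a # t"] assms(1) left(1) by simp
      ultimately show ?thesis
        by simp
    qed
  qed
qed

text \<open>
  In a raised path the two outer steps can only match each other: a partner of either one inside
  the enclosed path would force that path below its starting height.
\<close>

lemma matching_decorations_agree_raising:
  assumes "motzkin_path p" "matching_decorations_agree p"
  shows "matching_decorations_agree (raising w p)"
proof (rule matching_decorations_agreeI)
  fix u a m b v
  assume eq: "raising w p = u @ Up a # m @ Down b # v" and m: "motzkin_path m"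
  show "a = b"
  proof (cases u)
    case Nil
    then have aw: "a = w" and p: "p @ [Down w] = m @ Down b # v"
      using eq by (auto simp: raising_def)
    show ?thesis
    proof (cases v rule: rev_cases)
      case Nil
      then show ?thesis
        using aw p by auto
    next
      case (snoc v' s)
      then have "p = (m @ [Down b]) @ v'"
        using p by simp
      then have "0 \<le> height (m @ [Down b])"
        using motzkin_path_prefix assms(1) by blast
      then show ?thesis
        using motzkin_path_height[OF m] by simp
    qed
  next
    case (Cons s u')
    then have p: "p @ [Down w] = u' @ Up a # m @ Down b # v"
      using eq by (simp add: raising_def)
    show ?thesis
    proof (cases v rule: rev_cases)
      case Nil
      have "p @ [Down w] = (u' @ Up a # m) @ [Down b]"
        using p Nil by simp
      then have "p = u' @ Up a # m"
        by (simp only: append1_eq_conv)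
      then have "height (Up a # m) \<le> 0"
        using motzkin_path_suffix assms(1) by blast
      then show ?thesis
        using motzkin_path_height[OF m] by simp
    next
      case (snoc v' s')
      have "p @ [Down w] = (u' @ Up a # m @ Down b # v') @ [s']"
        using p snoc by simp
      then have "p = u' @ Up a # m @ Down b # v'"
        by (simp only: append1_eq_conv)
      then show ?thesis
        by (rule matching_decorations_agreeD[OF assms(2) _ m])
    qed
  qed
qed

lemma Nil_in_motzkin_paths: "[] \<in> motzkin_paths X \<Omega>"
  by (simp add: motzkin_paths_def motzkin_path_Nil matching_decorations_agree_def)

lemma level_path_in_motzkin_paths: "x \<in> X \<Longrightarrow> level_path x \<in> motzkin_paths X \<Omega>"
  by (auto simp: motzkin_paths_def motzkin_path_iff matching_decorations_agree_def level_path_def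
      Cons_eq_append_conv)

lemma link_in_motzkin_paths:
  "p \<in> motzkin_paths X \<Omega> \<Longrightarrow> q \<in> motzkin_paths X \<Omega> \<Longrightarrow> link p q \<in> motzkin_paths X \<Omega>"
  by (auto simp: motzkin_paths_def link_def motzkin_path_append matching_decorations_agree_append)

lemma raising_in_motzkin_paths:
  assumes "w \<in> \<Omega>" "p \<in> motzkin_paths X \<Omega>"
  shows "raising w p \<in> motzkin_paths X \<Omega>"
  using assms motzkin_path_raising[of p w] matching_decorations_agree_raising[of p w]
  by (auto simp: motzkin_paths_def raising_def)

section \<open>Generation by level steps\<close>

lemma factor_in_motzkin_paths:
  assumes "l @ p @ r \<in> motzkin_paths X \<Omega>" "motzkin_path p"
  shows "p \<in> motzkin_paths X \<Omega>"
  using assms matching_decorations_agree_factor by (auto simp: motzkin_paths_def)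

text \<open>
  The decomposition of a nontrivial path at its first return to the axis. An initial up step and
  the first down step that returns to the axis are a matching pair, hence equally decorated, so
  they raise the path between them.
\<close>

lemma motzkin_paths_cases:
  assumes p: "p \<in> motzkin_paths X \<Omega>"
  obtains (trivial) "p = []"
    | (level) x q where "x \<in> X" "q \<in> motzkin_paths X \<Omega>" "p = link (level_path x) q"
    | (raising) w q r where "w \<in> \<Omega>" "q \<in> motzkin_paths X \<Omega>" "r \<in> motzkin_paths X \<Omega>"
        "p = link (raising w q) r"
proof (cases p)
  case Nil
  then show ?thesis
    by (rule trivial)
next
  case (Cons s t)
  have mp: "motzkin_path p"
    using p by (simp add: motzkin_paths_def)
  show ?thesis
  proof (cases s)
    case (Level x)
    have "x \<in> X"
      using p Cons Level by (simp add: motzkin_paths_def)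
    moreover have "motzkin_path t"
      using motzkin_path_append_right[of "[s]" t] mp Cons Level by simp
    then have "t \<in> motzkin_paths X \<Omega>"
      using factor_in_motzkin_paths[of "[s]" t "[]"] p Cons by simp
    ultimately show ?thesis
      using level Cons Level by (simp add: link_def level_path_def)
  next
    case (Down w)
    have "0 \<le> height [s]"
      using motzkin_path_prefix[of "[s]" t] mp Cons by simp
    then show ?thesis
      using Down by simp
  next
    case (Up w)
    have "height t < 0"
      using motzkin_path_height[OF mp] Cons Up by simp
    then obtain q w' r where t: "t = q @ Down w' # r" and q: "motzkin_path q"
      by (rule first_descent)
    have p_eq: "p = [] @ Up w # q @ Down w' # r"
      using Cons Up t by simp
    have "matching_decorations_agree p"
      using p by (simp add: motzkin_paths_def)
    then have "w = w'"
      using p_eq q by (rule matching_decorations_agreeD)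
    then have p_link: "p = raising w q @ r"
      using p_eq by (simp add: raising_def)
    have "height (raising w q) = 0"
      using motzkin_path_height[OF q] by (simp add: raising_def)
    then have "motzkin_path r"
      using motzkin_path_append_right[of "raising w q" r] mp p_link by simp
    then have "r \<in> motzkin_paths X \<Omega>"
      using factor_in_motzkin_paths[of "raising w q" r "[]"] p p_link by simp
    moreover have "q \<in> motzkin_paths X \<Omega>"
      using factor_in_motzkin_paths[of "[Up w]" q "Down w' # r"] p p_eq q by simp
    moreover have "w \<in> \<Omega>"
      using p p_eq by (simp add: motzkin_paths_def)
    ultimately show ?thesis
      using raising p_link by (simp add: link_def)
  qed
qed

lemma motzkin_paths_induct [consumes 1, case_names trivial level raising link]:
  assumes "p \<in> motzkin_paths X \<Omega>"
    and trivial: "P []"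
    and level: "\<And>x. x \<in> X \<Longrightarrow> P (level_path x)"
    and raising: "\<And>w q. w \<in> \<Omega> \<Longrightarrow> q \<in> motzkin_paths X \<Omega> \<Longrightarrow> P q \<Longrightarrow> P (raising w q)"
    and link: "\<And>q r. q \<in> motzkin_paths X \<Omega> \<Longrightarrow> r \<in> motzkin_paths X \<Omega> \<Longrightarrow> P q \<Longrightarrow> P r \<Longrightarrow>
      P (link q r)"
  shows "P p"
  using assms(1)
proof (induction p rule: length_induct)
  case (1 p)
  from "1.prems" show ?case
  proof (cases rule: motzkin_paths_cases)
    case trivial
    then show ?thesis
      using assms(2) by simp
  next
    case (level x q)
    then have "P q"
      using "1.IH" by (simp add: link_def level_path_def)
    then show ?thesis
      using level assms(3) link[OF level_path_in_motzkin_paths] by simp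
  next
    case (raising w q r)
    then have "P q" "P r"
      using "1.IH" by (simp_all add: link_def raising_def)
    then show ?thesis
      using raising assms(4) link[OF raising_in_motzkin_paths] by simp
  qed
qed

section \<open>Peak-free paths\<close>

lemma peak_free_level_path: "peak_free (level_path x)"
  by (auto simp: peak_free_def level_path_def Cons_eq_append_conv)

text \<open>
  Linking and raising create a new consecutive pair of steps only next to an end of one of the
  given paths, and a nontrivial Motzkin path neither begins with a down step nor ends with an up
  step.
\<close>

lemma peak_free_link:
  assumes "motzkin_path p" "peak_free p" "peak_free q"
  shows "peak_free (link p q)"
  unfolding peak_free_def
proof (intro conjI notI)
  assume "link p q = []"
  then show False
    using assms(2) by (simp add: link_def peak_free_def)
next
  assume "\<exists>u a b v. link p q = u @ [Up a, Down b] @ v"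
  then obtain u a b v where "p @ q = u @ Up a # Down b # v"
    by (auto simp: link_def)
  then show False
  proof (cases rule: append_eq_append_ConsE)
    case right
    then show ?thesis
      using assms(3) by (auto simp: peak_free_def)
  next
    case (left t)
    show ?thesis
    proof (cases t)
      case Nil
      then show ?thesis
        using left(1) motzkin_path_suffix[of u "[Up a]"] assms(1) by simp
    next
      case (Cons s t')
      then show ?thesis
        using left assms(2) by (auto simp: peak_free_def)
    qed
  qed
qed

lemma peak_free_raising:
  assumes "motzkin_path p" "peak_free p"
  shows "peak_free (raising w p)"
  unfolding peak_free_def
proof (intro conjI notI)
  assume "raising w p = []"
  then show False
    by (simp add: raising_def)
next
  assume "\<exists>u a b v. raising w p = u @ [Up a, Down b] @ v"
  then obtain u a b v where eq: "Up w # p @ [Down w] = u @ Up a # Down b # v"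
    by (auto simp: raising_def)
  have "p \<noteq> []"
    using assms(2) by (simp add: peak_free_def)
  have "(\<exists>t. p = [Down b] @ t) \<or> (\<exists>t. p = t @ [Up a]) \<or> (\<exists>t t'. p = t @ [Up a, Down b] @ t')"
  proof (cases u)
    case Nil
    then have "p @ [Down w] = Down b # v"
      using eq by auto
    then show ?thesis
      using \<open>p \<noteq> []\<close> by (cases p) auto
  next
    case (Cons s u')
    then have "p @ [Down w] = u' @ Up a # Down b # v"
      using eq by simp
    then obtain t where "p = u' @ Up a # t" "t @ [Down w] = Down b # v"
    proof (cases rule: append_eq_append_ConsE)
      case (right t)
      then show ?thesis
        by (cases t) auto
    qed
    then show ?thesis
      by (cases t) auto
  qed
  then consider t where "p = [Down b] @ t" | t where "p = t @ [Up a]"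
    | t t' where "p = t @ [Up a, Down b] @ t'"
    by blast
  then show False
  proof cases
    case 1
    then show False
      using motzkin_path_prefix[of "[Down b]" t] assms(1) by simp
  next
    case 2
    then show False
      using motzkin_path_suffix[of t "[Up a]"] assms(1) by simp
  next
    case 3
    then show False
      using assms(2) by (auto simp: peak_free_def)
  qed
qed

lemma peak_free_factor:
  assumes "peak_free (l @ p @ r)" "p \<noteq> []"
  shows "peak_free p"
  unfolding peak_free_def
proof (intro conjI notI)
  assume "\<exists>u a b v. p = u @ [Up a, Down b] @ v"
  then obtain u a b v where "l @ p @ r = (l @ u) @ [Up a, Down b] @ (v @ r)"
    by auto
  then show False
    using assms(1) unfolding peak_free_def by blast
qed (use assms(2) in simp)

text \<open>
  In a generating expression for a peak-free path, trivial factors of links can be dropped, and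
  the trivial path is never raised because this would be a peak.
\<close>

lemma peak_free_paths_induct [consumes 1, case_names level raising link]:
  assumes "p \<in> peak_free_paths X \<Omega>"
    and level: "\<And>x. x \<in> X \<Longrightarrow> P (level_path x)"
    and raising: "\<And>w q. w \<in> \<Omega> \<Longrightarrow> q \<in> peak_free_paths X \<Omega> \<Longrightarrow> P q \<Longrightarrow> P (raising w q)"
    and link: "\<And>q r. q \<in> peak_free_paths X \<Omega> \<Longrightarrow> r \<in> peak_free_paths X \<Omega> \<Longrightarrow> P q \<Longrightarrow> P r \<Longrightarrow>
      P (link q r)"
  shows "P p"
proof -
  have "p \<in> motzkin_paths X \<Omega>" "peak_free p"
    using assms(1) by (auto simp: peak_free_paths_def)
  then show ?thesis
  proof (induction p rule: motzkin_paths_induct)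
    case trivial
    then show ?case
      by (simp add: peak_free_def)
  next
    case (level x)
    then show ?case
      using assms(2) by blast
  next
    case (raising w q)
    have "q \<noteq> []"
    proof
      assume "q = []"
      then have "raising w q = [] @ [Up w, Down w] @ []"
        by (simp add: raising_def)
      then show False
        using raising.prems unfolding peak_free_def by blast
    qed
    then have "peak_free q"
      using raising.prems peak_free_factor[of "[Up w]" q] by (simp add: raising_def)
    then show ?case
      using raising assms(3) by (simp add: peak_free_paths_def)
  next
    case (link q r)
    have "peak_free q" if "q \<noteq> []"
      using that link.prems peak_free_factor[of "[]" q r] by (simp add: link_def)
    moreover have "peak_free r" if "r \<noteq> []"
      using that link.prems peak_free_factor[of q r "[]"] by (simp add: link_def)
    ultimately show ?case
      using link assms(4)[of q r] by (cases "q = []"; cases "r = []")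
        (auto simp: peak_free_paths_def link_def)
  qed
qed

section \<open>The free operated monoid\<close>

lemma operated_monoid_motzkin: "operated_monoid \<Omega> (motzkin_monoid X \<Omega>) raising"
  unfolding operated_monoid_def
proof
  show "monoid (motzkin_monoid X \<Omega>)"
    by (rule monoidI) (auto simp: motzkin_monoid_def link_in_motzkin_paths Nil_in_motzkin_paths,
        auto simp: link_def)
qed (auto simp: motzkin_monoid_def raising_in_motzkin_paths)

text \<open>
  The second equation for a down step concerns an empty stack, which does not occur while a
  Motzkin path is read; its value is arbitrary.
\<close>

fun stack_eval ::
    "'h monoid \<Rightarrow> ('w \<Rightarrow> 'h \<Rightarrow> 'h) \<Rightarrow> ('x \<Rightarrow> 'h) \<Rightarrow> 'h list \<Rightarrow> 'h \<Rightarrow> ('x, 'w) step list \<Rightarrow> 'h" where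
  "stack_eval V \<beta> f st c [] = c"
| "stack_eval V \<beta> f st c (Level x # p) = stack_eval V \<beta> f st (c \<otimes>\<^bsub>V\<^esub> f x) p"
| "stack_eval V \<beta> f st c (Up w # p) = stack_eval V \<beta> f (c # st) \<one>\<^bsub>V\<^esub> p"
| "stack_eval V \<beta> f (d # st) c (Down w # p) = stack_eval V \<beta> f st (d \<otimes>\<^bsub>V\<^esub> \<beta> w c) p"
| "stack_eval V \<beta> f [] c (Down w # p) = c"

definition path_value ::
    "'h monoid \<Rightarrow> ('w \<Rightarrow> 'h \<Rightarrow> 'h) \<Rightarrow> ('x \<Rightarrow> 'h) \<Rightarrow> ('x, 'w) step list \<Rightarrow> 'h" where
  "path_value V \<beta> f p = stack_eval V \<beta> f [] \<one>\<^bsub>V\<^esub> p"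

context
  fixes \<Omega> :: "'w set" and X :: "'x set" and V :: "'h monoid" and \<beta> :: "'w \<Rightarrow> 'h \<Rightarrow> 'h"
    and f :: "'x \<Rightarrow> 'h"
  assumes V: "operated_monoid \<Omega> V \<beta>" and f: "f \<in> X \<rightarrow> carrier V"
begin

interpretation monoid V
  using V by (simp add: operated_monoid_def)

lemma operator_closed: "w \<in> \<Omega> \<Longrightarrow> h \<in> carrier V \<Longrightarrow> \<beta> w h \<in> carrier V"
  using V by (auto simp: operated_monoid_def)

text \<open>
  The stack, the current product and the remaining steps have to be arbitrary here because the
  machine meets a subpath in the middle of its run.
\<close>

lemma stack_eval_append:
  assumes "p \<in> motzkin_paths X \<Omega>"
  shows "path_value V \<beta> f p \<in> carrier V \<and>
    (\<forall>st. \<forall>c\<in>carrier V. \<forall>r.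
      stack_eval V \<beta> f st c (p @ r) = stack_eval V \<beta> f st (c \<otimes>\<^bsub>V\<^esub> path_value V \<beta> f p) r)"
  using assms
proof (induction p rule: motzkin_paths_induct)
  case trivial
  then show ?case
    by (simp add: path_value_def)
next
  case (level x)
  then have "f x \<in> carrier V"
    using f by auto
  then show ?case
    by (simp add: path_value_def level_path_def)
next
  case (raising w q)
  have "path_value V \<beta> f (raising w q) = \<beta> w (path_value V \<beta> f q)"
    unfolding path_value_def[of V \<beta> f "raising w q"]
    using raising operator_closed by (simp add: raising_def)
  then show ?case
    using raising operator_closed by (simp add: raising_def)
next
  case (link q r)
  have "path_value V \<beta> f (link q r) = path_value V \<beta> f q \<otimes>\<^bsub>V\<^esub> path_value V \<beta> f r"
  proof -
    have "path_value V \<beta> f (link q r) = stack_eval V \<beta> f [] (path_value V \<beta> f q) (r @ [])"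
      unfolding path_value_def[of V \<beta> f "link q r"]
      using link.IH(1) by (simp add: link_def)
    also have "\<dots> = path_value V \<beta> f q \<otimes>\<^bsub>V\<^esub> path_value V \<beta> f r"
      using link.IH by (simp del: append_Nil2)
    finally show ?thesis .
  qed
  then show ?case
    using link.IH by (simp add: link_def m_assoc)
qed

lemma path_value_closed: "p \<in> motzkin_paths X \<Omega> \<Longrightarrow> path_value V \<beta> f p \<in> carrier V"
  using stack_eval_append by blast

lemma path_value_level: "x \<in> X \<Longrightarrow> path_value V \<beta> f (level_path x) = f x"
  using f by (simp add: path_value_def level_path_def Pi_iff)

lemma path_value_link:
  assumes "p \<in> motzkin_paths X \<Omega>" "q \<in> motzkin_paths X \<Omega>"
  shows "path_value V \<beta> f (link p q) = path_value V \<beta> f p \<otimes>\<^bsub>V\<^esub> path_value V \<beta> f q"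
proof -
  have "path_value V \<beta> f (link p q) = stack_eval V \<beta> f [] (path_value V \<beta> f p) (q @ [])"
    unfolding path_value_def[of V \<beta> f "link p q"]
    using stack_eval_append[OF assms(1)] by (simp add: link_def)
  then show ?thesis
    using stack_eval_append[OF assms(2)] path_value_closed[OF assms(1)] by (simp del: append_Nil2)
qed

lemma path_value_raising:
  assumes "w \<in> \<Omega>" "p \<in> motzkin_paths X \<Omega>"
  shows "path_value V \<beta> f (raising w p) = \<beta> w (path_value V \<beta> f p)"
  unfolding path_value_def[of V \<beta> f "raising w p"]
  using stack_eval_append[OF assms(2)] operator_closed[OF assms(1)]
  by (simp add: raising_def)

end

lemma operated_monoid_hom_unique:
  assumes g: "g \<in> operated_monoid_hom \<Omega> (motzkin_monoid X \<Omega>) raising V \<beta>"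
    and g': "g' \<in> operated_monoid_hom \<Omega> (motzkin_monoid X \<Omega>) raising V \<beta>"
    and eq: "\<And>x. x \<in> X \<Longrightarrow> g (level_path x) = g' (level_path x)"
    and "p \<in> motzkin_paths X \<Omega>"
  shows "g p = g' p"
  using assms(4)
  by (induction p rule: motzkin_paths_induct)
    (use g g' eq in \<open>auto simp: operated_monoid_hom_def operated_semigroup_hom_def
       motzkin_monoid_def hom_def\<close>)

theorem free_operated_monoid_motzkin:
  "free_operated_monoid TYPE('h) \<Omega> X (motzkin_monoid X \<Omega>) raising level_path"
  unfolding free_operated_monoid_def
proof (intro conjI allI impI)
  show "operated_monoid \<Omega> (motzkin_monoid X \<Omega>) raising"
    by (rule operated_monoid_motzkin)
  show "level_path \<in> X \<rightarrow> carrier (motzkin_monoid X \<Omega>)"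
    by (auto simp: motzkin_monoid_def level_path_in_motzkin_paths)
next
  fix V :: "'h monoid" and \<beta> f
  assume V: "operated_monoid \<Omega> V \<beta>" and f: "f \<in> X \<rightarrow> carrier V"
  let ?U = "motzkin_monoid X \<Omega>"
  let ?g = "restrict (path_value V \<beta> f) (carrier ?U)"
  have "?g \<in> operated_monoid_hom \<Omega> ?U raising V \<beta>"
    using path_value_closed[OF V f] path_value_link[OF V f] path_value_raising[OF V f]
    by (auto simp: operated_monoid_hom_def operated_semigroup_hom_def hom_def motzkin_monoid_def
        link_in_motzkin_paths raising_in_motzkin_paths Nil_in_motzkin_paths path_value_def[of V \<beta> f "[]"])
  moreover have "\<forall>x\<in>X. f x = ?g (level_path x)"
    using path_value_level[OF V f] by (simp add: motzkin_monoid_def level_path_in_motzkin_paths)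
  ultimately show "\<exists>!g. g \<in> extensional (carrier ?U) \<and> g \<in> operated_monoid_hom \<Omega> ?U raising V \<beta> \<and>
      (\<forall>y\<in>X. f y = g (level_path y))"
  proof (intro ex1I[of _ ?g])
    fix g
    assume g: "g \<in> extensional (carrier ?U) \<and> g \<in> operated_monoid_hom \<Omega> ?U raising V \<beta> \<and>
      (\<forall>y\<in>X. f y = g (level_path y))"
    assume "?g \<in> operated_monoid_hom \<Omega> ?U raising V \<beta>" "\<forall>x\<in>X. f x = ?g (level_path x)"
    then have "g p = ?g p" if "p \<in> carrier ?U" for p
      using g that operated_monoid_hom_unique[of g \<Omega> X V \<beta> ?g p]
      by (auto simp: motzkin_monoid_def)
    then show "g = ?g"
      using g by (intro extensionalityI[of _ "carrier ?U"]) auto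
  qed simp
qed

text \<open>Without level decorations there are no level steps.\<close>

lemma dyck_monoid_eq:
  "(dyck_monoid \<Omega> :: ('x, 'w) step list monoid) = motzkin_monoid {} \<Omega>"
proof -
  have "no_level_steps p" if "p \<in> motzkin_paths {} \<Omega>" for p :: "('x, 'w) step list"
    using that by (auto simp: motzkin_paths_def no_level_steps_def)
  then show ?thesis
    by (auto simp: dyck_monoid_def motzkin_monoid_def dyck_paths_eq[of \<Omega> "{}"])
qed

section \<open>The free operated semigroup\<close>

text \<open>
  The value of the operators at the new unit is a free choice, since unit laws do not
  constrain them.
\<close>

definition adjoin_unit :: "'h monoid \<Rightarrow> 'h option monoid" where
  "adjoin_unit V = \<lparr>carrier = insert None (Some ` carrier V),
     mult = (\<lambda>a b. case a of None \<Rightarrow> b | Some x \<Rightarrow>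
       (case b of None \<Rightarrow> a | Some y \<Rightarrow> Some (x \<otimes>\<^bsub>V\<^esub> y))),
     one = None\<rparr>"

lemma operated_monoid_adjoin_unit:
  assumes "operated_semigroup \<Omega> V \<beta>"
  shows "operated_monoid \<Omega> (adjoin_unit V) (\<lambda>w. map_option (\<beta> w))"
  unfolding operated_monoid_def
proof
  show "monoid (adjoin_unit V)"
    by (rule monoidI)
      (use assms in \<open>auto simp: adjoin_unit_def operated_semigroup_def split: option.splits\<close>)
qed (use assms in \<open>force simp: adjoin_unit_def operated_semigroup_def Pi_iff\<close>)

lemma level_path_in_peak_free_paths: "x \<in> X \<Longrightarrow> level_path x \<in> peak_free_paths X \<Omega>"
  by (simp add: peak_free_paths_def level_path_in_motzkin_paths peak_free_level_path)

lemma link_in_peak_free_paths: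
  "p \<in> peak_free_paths X \<Omega> \<Longrightarrow> q \<in> peak_free_paths X \<Omega> \<Longrightarrow> link p q \<in> peak_free_paths X \<Omega>"
  by (auto simp: peak_free_paths_def link_in_motzkin_paths)
    (auto simp: motzkin_paths_def peak_free_link)

lemma raising_in_peak_free_paths:
  "w \<in> \<Omega> \<Longrightarrow> p \<in> peak_free_paths X \<Omega> \<Longrightarrow> raising w p \<in> peak_free_paths X \<Omega>"
  by (auto simp: peak_free_paths_def raising_in_motzkin_paths)
    (auto simp: motzkin_paths_def peak_free_raising)

lemma operated_semigroup_peak_free:
  "operated_semigroup \<Omega> (peak_free_semigroup X \<Omega>) raising"
  using link_in_peak_free_paths raising_in_peak_free_paths
  by (auto simp: operated_semigroup_def peak_free_semigroup_def) (simp add: link_def)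

lemma operated_semigroup_hom_unique:
  assumes g: "g \<in> operated_semigroup_hom \<Omega> (peak_free_semigroup X \<Omega>) raising V \<beta>"
    and g': "g' \<in> operated_semigroup_hom \<Omega> (peak_free_semigroup X \<Omega>) raising V \<beta>"
    and eq: "\<And>x. x \<in> X \<Longrightarrow> g (level_path x) = g' (level_path x)"
    and "p \<in> peak_free_paths X \<Omega>"
  shows "g p = g' p"
  using assms(4)
  by (induction p rule: peak_free_paths_induct)
    (use g g' eq in \<open>auto simp: operated_semigroup_hom_def peak_free_semigroup_def hom_def\<close>)

theorem free_operated_semigroup_peak_free:
  "free_operated_semigroup TYPE('h) \<Omega> X (peak_free_semigroup X \<Omega>) raising level_path"
  unfolding free_operated_semigroup_def
proof (intro conjI allI impI)
  show "operated_semigroup \<Omega> (peak_free_semigroup X \<Omega>) raising"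
    by (rule operated_semigroup_peak_free)
  show "level_path \<in> X \<rightarrow> carrier (peak_free_semigroup X \<Omega>)"
    by (auto simp: peak_free_semigroup_def level_path_in_peak_free_paths)
next
  fix V :: "'h monoid" and \<beta> f
  assume V: "operated_semigroup \<Omega> V \<beta>" and f: "f \<in> X \<rightarrow> carrier V"
  let ?U = "peak_free_semigroup X \<Omega>"
  let ?G = "path_value (adjoin_unit V) (\<lambda>w. map_option (\<beta> w)) (\<lambda>x. Some (f x))"
  note V1 = operated_monoid_adjoin_unit[OF V]
  have f1: "(\<lambda>x. Some (f x)) \<in> X \<rightarrow> carrier (adjoin_unit V)"
    using f by (auto simp: adjoin_unit_def)
  have sub: "p \<in> motzkin_paths X \<Omega>" if "p \<in> peak_free_paths X \<Omega>" for p
    using that by (simp add: peak_free_paths_def)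
  have G_level: "?G (level_path x) = Some (f x)" if "x \<in> X" for x
    using path_value_level[OF V1 f1] that .
  have G_link: "?G (link p q) = Some (a \<otimes>\<^bsub>V\<^esub> b)"
    if "p \<in> peak_free_paths X \<Omega>" "q \<in> peak_free_paths X \<Omega>" "?G p = Some a" "?G q = Some b"
    for p q a b
    using path_value_link[OF V1 f1, of p q] sub that by (simp add: adjoin_unit_def)
  have G_raising: "?G (raising w p) = Some (\<beta> w a)"
    if "w \<in> \<Omega>" "p \<in> peak_free_paths X \<Omega>" "?G p = Some a" for w p a
    using path_value_raising[OF V1 f1, of w p] sub that by simp
  have G_Some: "\<exists>a\<in>carrier V. ?G p = Some a" if "p \<in> peak_free_paths X \<Omega>" for p
    using that
  proof (induction p rule: peak_free_paths_induct)
    case (level x)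
    then show ?case
      using G_level f by auto
  next
    case (raising w q)
    then obtain a where "a \<in> carrier V" "?G q = Some a"
      by blast
    moreover from this have "\<beta> w a \<in> carrier V"
      using V raising(1) by (auto simp: operated_semigroup_def)
    ultimately show ?case
      using G_raising raising by blast
  next
    case (link q r)
    then obtain a b where "a \<in> carrier V" "?G q = Some a" "b \<in> carrier V" "?G r = Some b"
      by blast
    moreover from this have "a \<otimes>\<^bsub>V\<^esub> b \<in> carrier V"
      using V by (auto simp: operated_semigroup_def)
    ultimately show ?case
      using G_link link by blast
  qed
  let ?g = "restrict (\<lambda>p. the (?G p)) (carrier ?U)"
  have g_in: "?g p \<in> carrier V" if "p \<in> peak_free_paths X \<Omega>" for p
    using G_Some[OF that] that by (auto simp: peak_free_semigroup_def)
  have g_link: "?g (link p q) = ?g p \<otimes>\<^bsub>V\<^esub> ?g q"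
    if "p \<in> peak_free_paths X \<Omega>" "q \<in> peak_free_paths X \<Omega>" for p q
    using G_Some[OF that(1)] G_Some[OF that(2)] G_link[OF that] that
    by (auto simp: peak_free_semigroup_def link_in_peak_free_paths)
  have g_raising: "?g (raising w p) = \<beta> w (?g p)"
    if "w \<in> \<Omega>" "p \<in> peak_free_paths X \<Omega>" for w p
    using G_Some[OF that(2)] G_raising[OF that] that
    by (auto simp: peak_free_semigroup_def raising_in_peak_free_paths)
  have g_hom: "?g \<in> operated_semigroup_hom \<Omega> ?U raising V \<beta>"
    unfolding operated_semigroup_hom_def hom_def
    using g_in g_link g_raising by (auto simp: peak_free_semigroup_def)
  have g_level: "\<forall>x\<in>X. f x = ?g (level_path x)"
    using G_level by (simp add: peak_free_semigroup_def level_path_in_peak_free_paths)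
  show "\<exists>!g. g \<in> extensional (carrier ?U) \<and> g \<in> operated_semigroup_hom \<Omega> ?U raising V \<beta> \<and>
      (\<forall>y\<in>X. f y = g (level_path y))"
  proof (intro ex1I[of _ ?g])
    fix g
    assume g: "g \<in> extensional (carrier ?U) \<and> g \<in> operated_semigroup_hom \<Omega> ?U raising V \<beta> \<and>
      (\<forall>y\<in>X. f y = g (level_path y))"
    then have "g p = ?g p" if "p \<in> carrier ?U" for p
      using g_hom g_level that operated_semigroup_hom_unique[of g \<Omega> X V \<beta> ?g p]
      by (auto simp: peak_free_semigroup_def)
    then show "g = ?g"
      using g by (intro extensionalityI[of _ "carrier ?U"]) auto
  qed (use g_hom g_level in simp)
qed

theorem theorem2p1:
  fixes X :: "'x set" and \<Omega> :: "'w set"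
  assumes "X \<noteq> {}" and "\<Omega> \<noteq> {}"
  shows "free_operated_monoid TYPE('h) \<Omega> X (motzkin_monoid X \<Omega>) raising level_path \<and>
         free_operated_semigroup TYPE('h) \<Omega> X (peak_free_semigroup X \<Omega>) raising level_path \<and>
         free_operated_monoid TYPE('h) \<Omega> ({} :: 'x set)
           (dyck_monoid \<Omega> :: ('x, 'w) step list monoid) raising level_path"
  unfolding dyck_monoid_eq
  by (intro conjI free_operated_monoid_motzkin free_operated_semigroup_peak_free)

end
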